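(* Let $X$ be a finite-dimensional normed space over $\mathbb{R}$, and let $A$ and $B$ be nonempty convex compact subsets of $X$. Then the map $$f\colon \bigl[|A\,B|, +\infty\bigr) \to \mathcal{H}(X),\qquad f(r) = B_r(A)\cap B,$$ is continuous, where $\mathcal{H}(X)$ carries the topology generated by the Hausdorff metric $d_H$.
   Context: Let $X$ be a normed space with metric $|xy| = \|x-y\|$. For a point $p\in X$ and a nonempty set $A\subset X$, put $|pA| = \inf\{|pa| : a\in A\}$. For $r\ge 0$, the closed neighborhood of $A$ of radius $r$ is $B_r(A) = \{p\in X : |pA|\le r\}$. $\mathcal{H}(X)$ denotes the set of all nonempty closed bounded subsets of $X$, equipped with the Hausdorff metric $d_H(A,B) = \inf\{r : A\subset B_r(B),\ B\subset B_r(A)\}$. For $A,B\in\mathcal{H}(X)$ (with $X$ finite-dimensional), $|A\,B| = \min_{a\in A}|aB|$. The half-line $[|A\,B|,+\infty)$ has its usual topology as a subset of $\mathbb{R}$. *)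

theory Defs
  imports "HOL-Analysis.Analysis"
begin

definition closed_nbhd :: "real \<Rightarrow> 'a::metric_space set \<Rightarrow> 'a set"
  where "closed_nbhd r A = {p. infdist p A \<le> r}"

definition closed_bounded_sets :: "'a::metric_space set set"
  where "closed_bounded_sets = {A. A \<noteq> {} \<and> closed A \<and> bounded A}"

text \<open>
  The locale \<^locale>\<open>Metric_space\<close> demands a distance function that is symmetric and
  nonnegative on the whole type, so the value is fixed to be 0 as soon as one argument is not
  a nonempty closed bounded set.
\<close>

definition hausdorff_dist :: "'a::metric_space set \<Rightarrow> 'a set \<Rightarrow> real"
  where "hausdorff_dist A B =
    (if A \<in> closed_bounded_sets \<and> B \<in> closed_bounded_sets
     then Inf {r. 0 \<le> r \<and> A \<subseteq> closed_nbhd r B \<and> B \<subseteq> closed_nbhd r A} else 0)"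

abbreviation hausdorff_topology :: "'a::metric_space set topology"
  where "hausdorff_topology \<equiv> Metric_space.mtopology closed_bounded_sets hausdorff_dist"

definition finite_dim :: "'a::real_vector itself \<Rightarrow> bool"
  where "finite_dim _ \<longleftrightarrow> (\<exists>S::'a set. finite S \<and> span S = UNIV)"

text \<open>
  \<^const>\<open>Metric_space.mtopology\<close> is the metric topology only where the locale
  assumptions hold; they do.
\<close>

lemma hausdorff_radii_nonempty:
  fixes A B :: "'a::metric_space set"
  assumes "A \<in> closed_bounded_sets" "B \<in> closed_bounded_sets"
  shows "{r. 0 \<le> r \<and> A \<subseteq> closed_nbhd r B \<and> B \<subseteq> closed_nbhd r A} \<noteq> {}"
proof -
  have *: "\<exists>r. \<forall>s\<ge>r. C \<subseteq> closed_nbhd s D"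
    if CD: "C \<in> closed_bounded_sets" "D \<in> closed_bounded_sets" for C D :: "'a set"
  proof -
    obtain d where d: "d \<in> D" using CD by (auto simp: closed_bounded_sets_def)
    obtain r where r: "\<forall>x\<in>C. dist d x \<le> r"
      using CD bounded_any_center[of C d] by (auto simp: closed_bounded_sets_def)
    then have "C \<subseteq> closed_nbhd s D" if "s \<ge> r" for s
      using that r d by (force simp: closed_nbhd_def dist_commute intro: infdist_le2[OF d])
    then show ?thesis by blast
  qed
  from *[OF assms] obtain r1 where r1: "\<forall>s\<ge>r1. A \<subseteq> closed_nbhd s B" by blast
  from *[OF assms(2,1)] obtain r2 where r2: "\<forall>s\<ge>r2. B \<subseteq> closed_nbhd s A" by blast
  have "max 0 (max r1 r2) \<in> {r. 0 \<le> r \<and> A \<subseteq> closed_nbhd r B \<and> B \<subseteq> closed_nbhd r A}"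
    using r1 r2 by (simp add: max_def)
  then show ?thesis by blast
qed

lemma hausdorff_dist_le:
  assumes "A \<in> closed_bounded_sets" "B \<in> closed_bounded_sets"
    and "0 \<le> r" "A \<subseteq> closed_nbhd r B" "B \<subseteq> closed_nbhd r A"
  shows "hausdorff_dist A B \<le> r"
  unfolding hausdorff_dist_def using assms
  by (auto intro!: cInf_lower bdd_belowI[where m = 0])

lemma hausdorff_dist_nonneg: "0 \<le> hausdorff_dist A B"
  unfolding hausdorff_dist_def
  using cInf_greatest[OF hausdorff_radii_nonempty, of A B 0] by auto

lemma infdist_le_hausdorff_dist:
  assumes A: "A \<in> closed_bounded_sets" and B: "B \<in> closed_bounded_sets"
  shows "a \<in> A \<Longrightarrow> infdist a B \<le> hausdorff_dist A B"
    and "b \<in> B \<Longrightarrow> infdist b A \<le> hausdorff_dist A B"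
  unfolding hausdorff_dist_def using assms hausdorff_radii_nonempty[OF A B]
  by (auto intro!: cInf_greatest simp: closed_nbhd_def)

lemma infdist_trans_le:
  assumes "B \<noteq> {}" "infdist a B \<le> r" "\<And>b. b \<in> B \<Longrightarrow> infdist b C \<le> s"
  shows "infdist a C \<le> r + s"
proof -
  have "infdist a C - s \<le> (INF b\<in>B. dist a b)"
  proof (rule cINF_greatest[OF assms(1)])
    fix b assume "b \<in> B"
    then show "infdist a C - s \<le> dist a b"
      using infdist_triangle[of a C b] assms(3)[of b] by linarith
  qed
  then show ?thesis using assms by (simp add: infdist_notempty)
qed

lemma Metric_space_hausdorff:
  "Metric_space closed_bounded_sets (hausdorff_dist :: 'a::metric_space set \<Rightarrow> 'a set \<Rightarrow> real)"
proof
  fix A B C :: "'a set"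
  show "0 \<le> hausdorff_dist A B" by (rule hausdorff_dist_nonneg)
  show "hausdorff_dist A B = hausdorff_dist B A"
    by (auto simp: hausdorff_dist_def intro!: arg_cong[where f = Inf])
  assume A: "A \<in> closed_bounded_sets" and B: "B \<in> closed_bounded_sets"
  have ne: "A \<noteq> {}" "B \<noteq> {}" "closed A" "closed B"
    using A B by (auto simp: closed_bounded_sets_def)
  show "hausdorff_dist A B = 0 \<longleftrightarrow> A = B"
  proof
    assume "hausdorff_dist A B = 0"
    then have "\<And>a. a \<in> A \<Longrightarrow> infdist a B = 0" "\<And>b. b \<in> B \<Longrightarrow> infdist b A = 0"
      using infdist_le_hausdorff_dist[OF A B] by (metis antisym infdist_nonneg)+
    then show "A = B" using ne in_closed_iff_infdist_zero by blast
  next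
    assume "A = B"
    then have "hausdorff_dist A B \<le> 0"
      using A B by (intro hausdorff_dist_le) (auto simp: closed_nbhd_def)
    then show "hausdorff_dist A B = 0" using hausdorff_dist_nonneg[of A B] by linarith
  qed
  assume C: "C \<in> closed_bounded_sets"
  let ?r = "hausdorff_dist A B" and ?s = "hausdorff_dist B C"
  note AB = infdist_le_hausdorff_dist[OF A B] and BC = infdist_le_hausdorff_dist[OF B C]
  show "hausdorff_dist A C \<le> ?r + ?s"
  proof (rule hausdorff_dist_le[OF A C])
    show "0 \<le> ?r + ?s" by (simp add: hausdorff_dist_nonneg)
    show "A \<subseteq> closed_nbhd (?r + ?s) C"
      using infdist_trans_le[OF ne(2) AB(1) BC(1)] by (auto simp: closed_nbhd_def)
    show "C \<subseteq> closed_nbhd (?r + ?s) A"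
      using infdist_trans_le[OF ne(2) BC(2) AB(2)] by (auto simp: closed_nbhd_def add.commute)
  qed
qed

text \<open>
  For compact nonempty \<open>A\<close>, the library's \<^const>\<open>setdist\<close> is the minimum of the distances
  from points of \<open>A\<close> to \<open>B\<close>.
\<close>

lemma setdist_is_minimum:
  fixes A B :: "'a::metric_space set"
  assumes "compact A" "A \<noteq> {}"
  shows "\<exists>a\<in>A. setdist A B = infdist a B \<and> (\<forall>a'\<in>A. infdist a B \<le> infdist a' B)"
proof -
  have "continuous_on A (\<lambda>a. infdist a B)" by (intro continuous_intros)
  then obtain a where a: "a \<in> A" "\<forall>a'\<in>A. infdist a B \<le> infdist a' B"
    using continuous_attains_inf[OF assms] by blast
  then have "(INF a\<in>A. infdist a B) = infdist a B"
    by (intro cInf_eq_minimum) auto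
  then show ?thesis using a assms by (auto simp: setdist_eq_infdist)
qed

end

theory Submission
  imports Defs
begin

text \<open>
  Inside \<open>B\<close>, the set \<open>closed_nbhd r A \<inter> B\<close> is a sublevel set of the function
  \<open>infdist _ A\<close>, which is continuous, and convex because \<open>A\<close> is; its minimum over \<open>B\<close> is
  \<open>setdist A B\<close>. So the theorem is a case of a general fact: the sublevel sets of a continuous
  convex function \<open>g\<close> on a compact convex set depend continuously on the level, down to and
  including the minimum \<open>m\<close> (lemma \<open>continuous_map_sublevel\<close>).

  The sublevel sets are nested, so it suffices to move points of the larger one a short way into
  the smaller one. Above the minimum this is done by convexity: contracting towards a minimiser \<open>b\<close>
  with a small factor \<open>t\<close> lowers every level \<open>v\<close> to at most \<open>v - t * (v - m)\<close> and moves points of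
  the bounded set \<open>B\<close> by a multiple of \<open>t\<close> (\<open>infdist_sublevel_convex\<close>). The estimate
  degenerates at the level \<open>m\<close>. There only larger sublevel sets compete, and compactness
  suffices: points at distance at least \<open>e\<close> from the minimum set have values bounded away from
  \<open>m\<close> (\<open>infdist_sublevel_compact\<close>).
\<close>

lemma convex_on_infdist:
  fixes A :: "'a::real_normed_vector set"
  assumes "convex A" "A \<noteq> {}" "convex S"
  shows "convex_on S (\<lambda>x. infdist x A)"
proof (rule convex_onI[OF _ \<open>convex S\<close>])
  fix t :: real and x y :: 'a
  assume t: "0 < t" "t < 1"
  have near: "\<exists>a\<in>A. dist z a < infdist z A + e" if "0 < e" for z and e :: real
    using cInf_lessD[of "dist z ` A" "infdist z A + e"] that \<open>A \<noteq> {}\<close>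
    by (auto simp: infdist_notempty)
  show "infdist ((1 - t) *\<^sub>R x + t *\<^sub>R y) A \<le> (1 - t) * infdist x A + t * infdist y A"
  proof (rule field_le_epsilon)
    fix e :: real assume "0 < e"
    obtain a where a: "a \<in> A" "dist x a < infdist x A + e" using near[OF \<open>0 < e\<close>] by blast
    obtain b where b: "b \<in> A" "dist y b < infdist y A + e" using near[OF \<open>0 < e\<close>] by blast
    have "(1 - t) *\<^sub>R a + t *\<^sub>R b \<in> A"
      using \<open>convex A\<close> a b t by (auto simp: convex_alt)
    then have "infdist ((1 - t) *\<^sub>R x + t *\<^sub>R y) A
        \<le> dist ((1 - t) *\<^sub>R x + t *\<^sub>R y) ((1 - t) *\<^sub>R a + t *\<^sub>R b)"
      by (rule infdist_le)
    also have "\<dots> = norm ((1 - t) *\<^sub>R (x - a) + t *\<^sub>R (y - b))"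
      by (simp add: dist_norm algebra_simps)
    also have "\<dots> \<le> (1 - t) * dist x a + t * dist y b"
      using norm_triangle_ineq[of "(1 - t) *\<^sub>R (x - a)" "t *\<^sub>R (y - b)"] t
      by (simp add: dist_norm)
    also have "\<dots> \<le> (1 - t) * (infdist x A + e) + t * (infdist y A + e)"
      using a b t by (intro add_mono mult_left_mono) auto
    also have "\<dots> = (1 - t) * infdist x A + t * infdist y A + e"
      by (simp add: algebra_simps)
    finally show "infdist ((1 - t) *\<^sub>R x + t *\<^sub>R y) A
        \<le> (1 - t) * infdist x A + t * infdist y A + e" .
  qed
qed

text \<open>
  The point \<open>p\<close> is moved towards \<open>b\<close> by exactly the fraction \<open>(v - u) / (v - g b)\<close> of the
  segment, at which the convexity bound for \<open>g\<close> drops from \<open>v\<close> to \<open>u\<close>.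
\<close>

lemma infdist_sublevel_convex:
  fixes g :: "'a::real_normed_vector \<Rightarrow> real"
  assumes g: "convex_on B g" and b: "b \<in> B" and p: "p \<in> B" "g p \<le> v"
    and uv: "g b \<le> u" "u \<le> v" "g b < v"
  shows "infdist p {x \<in> B. g x \<le> u} \<le> (v - u) / (v - g b) * dist p b"
proof -
  define t where "t = (v - u) / (v - g b)"
  have t: "0 \<le> t" "t \<le> 1" using uv by (auto simp: t_def divide_simps)
  define q where "q = (1 - t) *\<^sub>R p + t *\<^sub>R b"
  have "q \<in> B"
    using convex_on_imp_convex[OF g] b p t by (auto simp: q_def convex_alt)
  moreover have "g q \<le> u"
  proof -
    have "g q \<le> (1 - t) * g p + t * g b"
      using convex_onD[OF g t p(1) b] by (simp add: q_def)
    also have "\<dots> \<le> (1 - t) * v + t * g b"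
      using p t by (intro add_right_mono mult_left_mono) auto
    also have "\<dots> = v - t * (v - g b)" by (simp add: algebra_simps)
    also have "\<dots> = u" using uv by (simp add: t_def)
    finally show ?thesis .
  qed
  moreover have "dist p q = t * dist p b"
  proof -
    have "p - q = t *\<^sub>R (p - b)" by (simp add: q_def algebra_simps)
    then show ?thesis using t by (simp add: dist_norm)
  qed
  ultimately show ?thesis using infdist_le[of q "{x \<in> B. g x \<le> u}" p] by (simp add: t_def)
qed

lemma infdist_sublevel_compact:
  fixes g :: "'a::metric_space \<Rightarrow> real"
  assumes "compact B" and g: "continuous_on B g" and "0 < e"
  obtains d where "0 < d" "\<And>p. p \<in> B \<Longrightarrow> g p < m + d \<Longrightarrow> infdist p {x \<in> B. g x \<le> m} < e"
proof -
  define K where "K = B \<inter> {p. e \<le> infdist p {x \<in> B. g x \<le> m}}"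
  have "closed {p. e \<le> infdist p {x \<in> B. g x \<le> m}}"
    by (intro closed_Collect_le continuous_intros)
  with \<open>compact B\<close> have "compact K" unfolding K_def by (rule compact_Int_closed)
  show thesis
  proof (cases "K = {}")
    case True
    then show ?thesis using that[of 1] by (force simp: K_def)
  next
    case False
    have "continuous_on K g" using g by (rule continuous_on_subset) (simp add: K_def)
    then obtain p0 where p0: "p0 \<in> K" "\<And>p. p \<in> K \<Longrightarrow> g p0 \<le> g p"
      using continuous_attains_inf[OF \<open>compact K\<close> False] by blast
    have "m < g p0"
    proof (rule ccontr)
      assume "\<not> m < g p0"
      then have "infdist p0 {x \<in> B. g x \<le> m} = 0" using p0(1) by (simp add: K_def)
      with p0(1) \<open>0 < e\<close> show False by (simp add: K_def)
    qed
    with p0(2) show ?thesis by (intro that[of "g p0 - m"]) (force simp: K_def)+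
  qed
qed

lemma hausdorff_dist_nested_le:
  assumes "C \<in> closed_bounded_sets" "D \<in> closed_bounded_sets" "C \<subseteq> D" "0 \<le> e"
    and "\<And>p. p \<in> D \<Longrightarrow> infdist p C \<le> e"
  shows "hausdorff_dist C D \<le> e"
proof (rule hausdorff_dist_le)
  show "C \<subseteq> closed_nbhd e D"
    using assms(3,4) by (auto simp: closed_nbhd_def subset_iff)
qed (use assms in \<open>auto simp: closed_nbhd_def\<close>)

lemma continuous_map_sublevel:
  fixes g :: "'a::real_normed_vector \<Rightarrow> real"
  assumes "compact B" and cont: "continuous_on B g" and conv: "convex_on B g"
    and b: "b \<in> B" "\<And>x. x \<in> B \<Longrightarrow> g b \<le> g x"
  shows "continuous_map (top_of_set {g b..}) hausdorff_topology (\<lambda>r. {x \<in> B. g x \<le> r})"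
proof -
  interpret H: Metric_space "closed_bounded_sets :: 'a set set" hausdorff_dist
    by (rule Metric_space_hausdorff)
  define F where "F r = {x \<in> B. g x \<le> r}" for r
  have F: "F r \<in> closed_bounded_sets" if "g b \<le> r" for r
  proof -
    have "F r = B \<inter> g -` {..r}" by (auto simp: F_def)
    moreover have "closed (B \<inter> g -` {..r})"
      using cont compact_imp_closed[OF \<open>compact B\<close>] closed_atMost
      by (rule continuous_closed_preimage)
    moreover have "bounded (F r)"
      using compact_imp_bounded[OF \<open>compact B\<close>] by (rule bounded_subset) (auto simp: F_def)
    ultimately show ?thesis using b that by (auto simp: closed_bounded_sets_def F_def)
  qed
  have nested: "hausdorff_dist (F u) (F v) \<le> e"
    if "g b \<le> u" "u \<le> v" "0 \<le> e" "\<And>p. p \<in> F v \<Longrightarrow> infdist p (F u) \<le> e" for u v e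
    using that by (intro hausdorff_dist_nested_le F) (auto simp: F_def)
  obtain D where D: "0 < D" "\<And>p. p \<in> B \<Longrightarrow> dist p b \<le> D"
  proof -
    obtain D where "\<forall>p\<in>B. dist b p \<le> D"
      using compact_imp_bounded[OF \<open>compact B\<close>] bounded_any_center[of B b] by blast
    then show ?thesis using that[of "max D 1"] by (force simp: dist_commute)
  qed
  have lip: "hausdorff_dist (F u) (F v) \<le> (v - u) / (v - g b) * D"
    if "g b \<le> u" "u \<le> v" "g b < v" for u v
  proof (rule nested[OF that(1,2)])
    show "0 \<le> (v - u) / (v - g b) * D" using that D by simp
    fix p assume p: "p \<in> F v"
    have "infdist p (F u) \<le> (v - u) / (v - g b) * dist p b"
      using infdist_sublevel_convex[OF conv b(1) _ _ that] p by (simp add: F_def)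
    also have "\<dots> \<le> (v - u) / (v - g b) * D"
      using D p that by (intro mult_left_mono) (auto simp: F_def)
    finally show "infdist p (F u) \<le> (v - u) / (v - g b) * D" .
  qed
  have close: "\<exists>d>0. \<forall>s\<ge>g b. \<bar>s - r\<bar> < d \<longrightarrow> hausdorff_dist (F r) (F s) < e"
    if r: "g b \<le> r" and e: "0 < e" for r e
  proof (cases "r = g b")
    case True
    obtain d where d: "0 < d" "\<And>p. p \<in> B \<Longrightarrow> g p < r + d \<Longrightarrow> infdist p (F r) < e / 2"
      using infdist_sublevel_compact[OF \<open>compact B\<close> cont half_gt_zero[OF e], of r]
      unfolding F_def by blast
    have "hausdorff_dist (F r) (F s) < e" if s: "g b \<le> s" "\<bar>s - r\<bar> < d" for s
    proof -
      have "hausdorff_dist (F r) (F s) \<le> e / 2"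
      proof (rule nested)
        fix p assume "p \<in> F s"
        then have "p \<in> B" "g p < r + d" using s by (auto simp: F_def)
        then show "infdist p (F r) \<le> e / 2" using d(2) by force
      qed (use True s e in auto)
      then show ?thesis using e by simp
    qed
    with d(1) show ?thesis by blast
  next
    case False
    with r have r': "0 < r - g b" by simp
    define d where "d = e * (r - g b) / D"
    have "hausdorff_dist (F r) (F s) < e" if s: "g b \<le> s" "\<bar>s - r\<bar> < d" for s
    proof -
      \<comment> \<open>the larger of the two levels is at least \<open>r\<close>, which keeps the denominator in the
        Lipschitz estimate away from 0 on both sides of \<open>r\<close>\<close>
      have "hausdorff_dist (F r) (F s) \<le> \<bar>s - r\<bar> / (max r s - g b) * D"
      proof (cases "r \<le> s")
        case True
        then show ?thesis using lip[of r s] r' by (simp add: max_def)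
      next
        case False
        then show ?thesis using lip[of s r] r' s by (simp add: max_def H.commute)
      qed
      also have "\<dots> \<le> \<bar>s - r\<bar> / (r - g b) * D"
        using r' D by (intro mult_right_mono divide_left_mono) auto
      also have "\<dots> < d / (r - g b) * D"
        using r' D s by (intro mult_strict_right_mono divide_strict_right_mono) auto
      also have "\<dots> = e" using r' D by (simp add: d_def)
      finally show ?thesis .
    qed
    moreover have "0 < d" using e r' D by (simp add: d_def)
    ultimately show ?thesis by blast
  qed
  have "continuous_map (top_of_set {g b..}) H.mtopology F"
    unfolding H.continuous_map_to_metric
  proof (intro ballI allI impI)
    fix r and e :: real
    assume "r \<in> topspace (top_of_set {g b..})" and "0 < e"
    then have r: "g b \<le> r" by simp
    from close[OF r \<open>0 < e\<close>] obtain d where d: "0 < d"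
      "\<And>s. g b \<le> s \<Longrightarrow> \<bar>s - r\<bar> < d \<Longrightarrow> hausdorff_dist (F r) (F s) < e" by blast
    show "\<exists>U. openin (top_of_set {g b..}) U \<and> r \<in> U \<and> (\<forall>s\<in>U. F s \<in> H.mball (F r) e)"
    proof (intro exI conjI ballI)
      show "openin (top_of_set {g b..}) ({g b..} \<inter> ball r d)" by (intro openin_open_Int open_ball)
      show "r \<in> {g b..} \<inter> ball r d" using r d by simp
      fix s assume "s \<in> {g b..} \<inter> ball r d"
      then show "F s \<in> H.mball (F r) e"
        using r d F by (auto simp: dist_real_def abs_minus_commute)
    qed
  qed
  then show ?thesis by (simp add: F_def[abs_def])
qed

theorem mainTheorem1:
  fixes A B :: "'a::real_normed_vector set"
  assumes "finite_dim TYPE('a)"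
    and "A \<noteq> {}" and "convex A" and "compact A"
    and "B \<noteq> {}" and "convex B" and "compact B"
  shows "continuous_map (top_of_set {setdist A B..}) hausdorff_topology
           (\<lambda>r. closed_nbhd r A \<inter> B)"
proof -
  obtain b where b: "b \<in> B" "setdist A B = infdist b A" "\<And>x. x \<in> B \<Longrightarrow> infdist b A \<le> infdist x A"
    using setdist_is_minimum[OF \<open>compact B\<close> \<open>B \<noteq> {}\<close>, of A] by (auto simp: setdist_sym)
  have "continuous_map (top_of_set {infdist b A..}) hausdorff_topology
      (\<lambda>r. {x \<in> B. infdist x A \<le> r})"
    using \<open>compact B\<close> _ convex_on_infdist[OF \<open>convex A\<close> \<open>A \<noteq> {}\<close> \<open>convex B\<close>] b(1,3)
    by (rule continuous_map_sublevel) (intro continuous_intros)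
  moreover have "closed_nbhd r A \<inter> B = {x \<in> B. infdist x A \<le> r}" for r
    by (auto simp: closed_nbhd_def)
  ultimately show ?thesis by (simp add: b(2))
qed

end
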